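(* Let $\mathbf{Q}$ be a quantale and let $\{\mathbf{M}_i\}_{i\in I}$ be any family of $\mathbf{Q}$-modules. Let $\pi_i:\prod_{j\in I}\mathbf{M}_j\to\mathbf{M}_i$ be the canonical projections and let $\mu_i:\mathbf{M}_i\to\prod_{j\in I}\mathbf{M}_j$ be the right inverse of $\pi_i$ that sends $x\in M_i$ to the family whose $i$-th entry is $x$ and all of whose other entries are $\bot$. Then the product $\prod_{i\in I}\mathbf{M}_i$, equipped with the maps $\mu_i$, is the coproduct $\coprod_{i\in I}\mathbf{M}_i$ in the category of $\mathbf{Q}$-modules. Moreover $\pi_i\circ\mu_i=\mathrm{id}_{\mathbf{M}_i}$ for all $i\in I$.
   Context: A sup-lattice is a poset with arbitrary joins (bottom element $\bot$). A quantale $\mathbf{Q}=\langle Q,\vee,\cdot,\bot,e\rangle$ is a sup-lattice $\langle Q,\vee,\bot\rangle$ with a monoid structure $\langle Q,\cdot,e\rangle$ whose product distributes over arbitrary joins in both arguments. A left $\mathbf{Q}$-module is a sup-lattice $\mathbf{M}$ with a scalar multiplication $\star:Q\times M\to M$ preserving arbitrary joins in each argument and satisfying $(q_1q_2)\star m=q_1\star(q_2\star m)$ and $e\star m=m$; right modules are defined analogously. "$\mathbf{Q}$-module" means consistently left or consistently right module. Module homomorphisms preserve arbitrary joins and scalar multiplication. The product $\prod_{i}\mathbf{M}_i$ is the Cartesian product with operations and order defined coordinatewise. *)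

theory Defs
  imports "HOL-Algebra.Group"
begin

locale sup_lattice = partial_order L for L (structure) +
  assumes join_exists: "A \<subseteq> carrier L \<Longrightarrow> \<exists>s. least L s (Upper L A)"

record 'q quantale = "'q gorder" +
  qmult :: "['q, 'q] \<Rightarrow> 'q" (infixl \<open>\<odot>\<index>\<close> 70)
  qunit :: 'q

abbreviation mult_monoid :: "('q, 'a) quantale_scheme \<Rightarrow> 'q monoid" where
  "mult_monoid Q \<equiv> \<lparr>carrier = carrier Q, mult = qmult Q, one = qunit Q\<rparr>"

text \<open>Joins are taken over arbitrary subsets, including the empty one, here and below.\<close>

locale quantale = sup_lattice Q for Q (structure) +
  assumes is_monoid: "monoid (mult_monoid Q)"
    and mult_join_right:
      "\<lbrakk>a \<in> carrier Q; B \<subseteq> carrier Q\<rbrakk> \<Longrightarrow> a \<odot> (\<Squnion>B) = \<Squnion>((\<lambda>b. a \<odot> b) ` B)"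
    and mult_join_left:
      "\<lbrakk>A \<subseteq> carrier Q; b \<in> carrier Q\<rbrakk> \<Longrightarrow> (\<Squnion>A) \<odot> b = \<Squnion>((\<lambda>a. a \<odot> b) ` A)"

text \<open>
  The action always takes the scalar as its first argument; for a right module,
  \<open>act M q m\<close> is the action of \<open>q\<close> on \<open>m\<close> from the right. Left and right modules thus
  share everything but the associativity law.
\<close>

record ('q, 'm) qmodule = "'m gorder" +
  act :: "['q, 'm] \<Rightarrow> 'm" (infixr \<open>\<star>\<index>\<close> 75)

locale quantale_action = quantale Q + M: sup_lattice M
  for Q (structure) and M :: "('q, 'm, 'b) qmodule_scheme" (structure) +
  assumes act_closed: "\<lbrakk>q \<in> carrier Q; m \<in> carrier M\<rbrakk> \<Longrightarrow> q \<star>\<^bsub>M\<^esub> m \<in> carrier M"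
    and act_join_scalar:
      "\<lbrakk>A \<subseteq> carrier Q; m \<in> carrier M\<rbrakk>
        \<Longrightarrow> (\<Squnion>\<^bsub>Q\<^esub>A) \<star>\<^bsub>M\<^esub> m = \<Squnion>\<^bsub>M\<^esub>((\<lambda>q. q \<star>\<^bsub>M\<^esub> m) ` A)"
    and act_join_vector:
      "\<lbrakk>q \<in> carrier Q; B \<subseteq> carrier M\<rbrakk>
        \<Longrightarrow> q \<star>\<^bsub>M\<^esub> (\<Squnion>\<^bsub>M\<^esub>B) = \<Squnion>\<^bsub>M\<^esub>((\<lambda>m. q \<star>\<^bsub>M\<^esub> m) ` B)"
    and act_unit: "m \<in> carrier M \<Longrightarrow> qunit Q \<star>\<^bsub>M\<^esub> m = m"

locale left_qmodule = quantale_action +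
  assumes act_assoc:
    "\<lbrakk>p \<in> carrier Q; q \<in> carrier Q; m \<in> carrier M\<rbrakk>
      \<Longrightarrow> (p \<odot>\<^bsub>Q\<^esub> q) \<star>\<^bsub>M\<^esub> m = p \<star>\<^bsub>M\<^esub> (q \<star>\<^bsub>M\<^esub> m)"

locale right_qmodule = quantale_action +
  assumes act_assoc:
    "\<lbrakk>p \<in> carrier Q; q \<in> carrier Q; m \<in> carrier M\<rbrakk>
      \<Longrightarrow> (p \<odot>\<^bsub>Q\<^esub> q) \<star>\<^bsub>M\<^esub> m = q \<star>\<^bsub>M\<^esub> (p \<star>\<^bsub>M\<^esub> m)"

datatype side = Left | Right

definition qmodule :: "side \<Rightarrow> 'q quantale \<Rightarrow> ('q, 'm) qmodule \<Rightarrow> bool" where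
  "qmodule s Q M \<longleftrightarrow> (case s of Left \<Rightarrow> left_qmodule Q M | Right \<Rightarrow> right_qmodule Q M)"

text \<open>
  Morphisms are extensional (undefined outside the carrier of their domain), so that equality
  of functions is equality of morphisms; they are composed with \<open>compose\<close>.
\<close>

definition qmodule_hom ::
    "'q quantale \<Rightarrow> ('q, 'm) qmodule \<Rightarrow> ('q, 'n) qmodule \<Rightarrow> ('m \<Rightarrow> 'n) set" where
  "qmodule_hom Q M N = {h \<in> carrier M \<rightarrow>\<^sub>E carrier N.
     (\<forall>A. A \<subseteq> carrier M \<longrightarrow> h (\<Squnion>\<^bsub>M\<^esub>A) = \<Squnion>\<^bsub>N\<^esub>(h ` A)) \<and>
     (\<forall>q\<in>carrier Q. \<forall>m\<in>carrier M. h (q \<star>\<^bsub>M\<^esub> m) = q \<star>\<^bsub>N\<^esub> h m)}"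

definition prod_qmodule :: "'i set \<Rightarrow> ('i \<Rightarrow> ('q, 'm) qmodule) \<Rightarrow> ('q, 'i \<Rightarrow> 'm) qmodule" where
  "prod_qmodule I M =
     \<lparr>carrier = (\<Pi>\<^sub>E i\<in>I. carrier (M i)),
      eq = (=),
      le = (\<lambda>x y. \<forall>i\<in>I. x i \<sqsubseteq>\<^bsub>M i\<^esub> y i),
      act = (\<lambda>q x. \<lambda>i\<in>I. q \<star>\<^bsub>M i\<^esub> x i)\<rparr>"

definition proj :: "'i set \<Rightarrow> ('i \<Rightarrow> ('q, 'm) qmodule) \<Rightarrow> 'i \<Rightarrow> ('i \<Rightarrow> 'm) \<Rightarrow> 'm" where
  "proj I M i = (\<lambda>x\<in>carrier (prod_qmodule I M). x i)"

definition coproj :: "'i set \<Rightarrow> ('i \<Rightarrow> ('q, 'm) qmodule) \<Rightarrow> 'i \<Rightarrow> 'm \<Rightarrow> ('i \<Rightarrow> 'm)" where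
  "coproj I M i = (\<lambda>x\<in>carrier (M i). \<lambda>j\<in>I. if j = i then x else \<bottom>\<^bsub>M j\<^esub>)"

text \<open>
  A definition cannot quantify over types, so the carrier type \<open>'n\<close> of the test modules is a
  parameter; a theorem that leaves \<open>'n\<close> free asserts the universal property for all of them.
\<close>

definition is_coproduct ::
    "'n itself \<Rightarrow> side \<Rightarrow> 'q quantale \<Rightarrow> 'i set \<Rightarrow> ('i \<Rightarrow> ('q, 'm) qmodule)
      \<Rightarrow> ('q, 'c) qmodule \<Rightarrow> ('i \<Rightarrow> 'm \<Rightarrow> 'c) \<Rightarrow> bool" where
  "is_coproduct (_ :: 'n itself) s Q I M C \<iota> \<longleftrightarrow>
     qmodule s Q C \<and> (\<forall>i\<in>I. \<iota> i \<in> qmodule_hom Q (M i) C) \<and>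
     (\<forall>(N :: ('q, 'n) qmodule) f.
        qmodule s Q N \<and> (\<forall>i\<in>I. f i \<in> qmodule_hom Q (M i) N) \<longrightarrow>
        (\<exists>!g. g \<in> qmodule_hom Q C N \<and>
              (\<forall>i\<in>I. compose (carrier (M i)) g (\<iota> i) = f i)))"

end

(* The mediating morphism of a cocone f is x \<mapsto> \<Squnion>i. f i (x i). It preserves joins and the action
   because joins in the product are coordinatewise and joins commute with joins; it is unique
   because x is the join of the family \<mu> i (x i). *)
theory Submission
  imports Defs
begin

section \<open>Joins in a sup-lattice, bottom elements and homomorphisms\<close>

context sup_lattice
begin

text \<open>The join operator is a Hilbert choice; \<open>join_exists\<close> supplies the witness
  that makes the chosen element a genuine least upper bound.\<close>

lemma sup_is_lub:
  assumes "A \<subseteq> carrier L"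
  shows "is_lub L (\<Squnion>A) A"
  unfolding Lattice.sup_def using join_exists[OF assms] by (rule someI_ex)

lemma sup_in_carrier: "A \<subseteq> carrier L \<Longrightarrow> \<Squnion>A \<in> carrier L"
  by (rule least_closed[OF sup_is_lub])

lemma sup_le_iff:
  assumes A: "A \<subseteq> carrier L" and y: "y \<in> carrier L"
  shows "\<Squnion>A \<sqsubseteq> y \<longleftrightarrow> (\<forall>a\<in>A. a \<sqsubseteq> y)"
proof
  assume le: "\<Squnion>A \<sqsubseteq> y"
  show "\<forall>a\<in>A. a \<sqsubseteq> y"
  proof
    fix a assume "a \<in> A"
    then have "a \<sqsubseteq> \<Squnion>A" using least_Upper_above[OF sup_is_lub[OF A]] A by blast
    then show "a \<sqsubseteq> y" using le \<open>a \<in> A\<close> A y sup_in_carrier[OF A] le_trans by blast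
  qed
next
  assume "\<forall>a\<in>A. a \<sqsubseteq> y"
  then have "y \<in> Upper L A" using y by (auto intro: Upper_memI)
  then show "\<Squnion>A \<sqsubseteq> y" by (rule least_le[OF sup_is_lub[OF A]])
qed

text \<open>An element of a partial order is determined by the elements above it. The joins in the
  product and in the test module are all computed this way, by comparing upper bounds.\<close>

lemma sup_eqI:
  assumes A: "A \<subseteq> carrier L" and s: "s \<in> carrier L"
    and bound: "\<And>y. y \<in> carrier L \<Longrightarrow> s \<sqsubseteq> y \<longleftrightarrow> (\<forall>a\<in>A. a \<sqsubseteq> y)"
  shows "\<Squnion>A = s"
proof (rule le_antisym)
  \<comment> \<open>The two inequalities are \<open>bound\<close> read at \<open>s\<close> itself
    and at the join.\<close>
  show "\<Squnion>A \<sqsubseteq> s" using s bound[OF s] sup_le_iff[OF A s] by simp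
  show "s \<sqsubseteq> \<Squnion>A"
    using bound[OF sup_in_carrier[OF A]] sup_le_iff[OF A sup_in_carrier[OF A]] sup_in_carrier[OF A]
    by simp
qed (use s sup_in_carrier[OF A] in auto)

end

text \<open>Every element of the carrier is an upper bound of the empty set, so both sides choose a
  least element of the carrier. Preservation of arbitrary joins thereby includes preservation of
  bottom.\<close>

lemma sup_empty: "\<Squnion>\<^bsub>L\<^esub>{} = \<bottom>\<^bsub>L\<^esub>"
  by (simp add: Lattice.sup_def bottom_def)

lemma (in sup_lattice)
  shows bottom_in_carrier: "\<bottom> \<in> carrier L"
    and bottom_le: "x \<in> carrier L \<Longrightarrow> \<bottom> \<sqsubseteq> x"
  using sup_in_carrier[of "{}"] sup_le_iff[of "{}"] by (auto simp: sup_empty)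

text \<open>The case of the empty join; it keeps the bottom entries of an injected family at bottom
  under the action.\<close>

lemma (in quantale_action) act_bottom: "q \<in> carrier Q \<Longrightarrow> q \<star>\<^bsub>M\<^esub> \<bottom>\<^bsub>M\<^esub> = \<bottom>\<^bsub>M\<^esub>"
  using act_join_vector[of q "{}"] by (simp add: sup_empty)

lemma
  assumes "h \<in> qmodule_hom Q M N"
  shows hom_closed: "x \<in> carrier M \<Longrightarrow> h x \<in> carrier N"
    and hom_extensional: "h \<in> extensional (carrier M)"
    and hom_sup: "A \<subseteq> carrier M \<Longrightarrow> h (\<Squnion>\<^bsub>M\<^esub>A) = \<Squnion>\<^bsub>N\<^esub>(h ` A)"
    and hom_act: "\<lbrakk>q \<in> carrier Q; x \<in> carrier M\<rbrakk> \<Longrightarrow> h (q \<star>\<^bsub>M\<^esub> x) = q \<star>\<^bsub>N\<^esub> h x"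
  using assms by (auto simp: qmodule_hom_def PiE_iff)

text \<open>Again the empty join; it makes the bottom entries of an injected family contribute
  nothing to the mediating join.\<close>

lemma hom_bottom: "h \<in> qmodule_hom Q M N \<Longrightarrow> h \<bottom>\<^bsub>M\<^esub> = \<bottom>\<^bsub>N\<^esub>"
  using hom_sup[of h Q M N "{}"] by (simp add: sup_empty)

lemma qmodule_action: "qmodule s Q M \<Longrightarrow> quantale_action Q M"
  by (cases s) (auto simp: qmodule_def left_qmodule_def right_qmodule_def)

text \<open>Working with \<open>quantale_action\<close> treats left and right modules at once, since
  only associativity tells them apart. The assumption on \<open>Q\<close> stands on its own because
  an empty family would yield no information about it.\<close>

locale action_family =
  fixes Q :: "'q quantale" and I :: "'i set" and M :: "'i \<Rightarrow> ('q, 'm) qmodule"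
  assumes quantale: "quantale Q"
    and action: "i \<in> I \<Longrightarrow> quantale_action Q (M i)"
begin

abbreviation P where "P \<equiv> prod_qmodule I M"

lemma sup_lattice_factor: "i \<in> I \<Longrightarrow> sup_lattice (M i)"
  using action quantale_action.axioms(2) by blast

section \<open>Order and joins of the product\<close>

lemma prod_carrier: "carrier P = (\<Pi>\<^sub>E i\<in>I. carrier (M i))"
  by (simp add: prod_qmodule_def)

lemma prod_le: "x \<sqsubseteq>\<^bsub>P\<^esub> y \<longleftrightarrow> (\<forall>i\<in>I. x i \<sqsubseteq>\<^bsub>M i\<^esub> y i)"
  by (simp add: prod_qmodule_def)

lemma prod_act: "q \<star>\<^bsub>P\<^esub> x = (\<lambda>i\<in>I. q \<star>\<^bsub>M i\<^esub> x i)"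
  by (simp add: prod_qmodule_def)

lemma component_closed: "\<lbrakk>x \<in> carrier P; i \<in> I\<rbrakk> \<Longrightarrow> x i \<in> carrier (M i)"
  by (auto simp: prod_carrier)

lemma prod_eqI:
  assumes "x \<in> carrier P" "y \<in> carrier P" "\<And>i. i \<in> I \<Longrightarrow> x i = y i"
  shows "x = y"
  using assms by (auto simp: prod_carrier intro: PiE_ext)

lemma prod_partial_order: "partial_order P"
proof -
  have eq: "eq P = (=)" by (simp add: prod_qmodule_def)
  have po: "partial_order (M i)" if "i \<in> I" for i
    using sup_lattice_factor[OF that] by (simp add: sup_lattice_def)
  show ?thesis
  proof
    fix x assume "x \<in> carrier P"
    then show "x \<sqsubseteq>\<^bsub>P\<^esub> x"
      using weak_partial_order.le_refl[OF partial_order.axioms(1)[OF po]]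
      by (simp add: prod_le component_closed)
  next
    fix x y
    assume xy: "x \<sqsubseteq>\<^bsub>P\<^esub> y" "y \<sqsubseteq>\<^bsub>P\<^esub> x" "x \<in> carrier P" "y \<in> carrier P"
    have "x = y"
      using xy by (intro prod_eqI partial_order.le_antisym[OF po]) (auto simp: prod_le component_closed)
    then show "x .=\<^bsub>P\<^esub> y" by (simp add: eq)
  next
    fix x y z
    assume xyz: "x \<sqsubseteq>\<^bsub>P\<^esub> y" "y \<sqsubseteq>\<^bsub>P\<^esub> z" "x \<in> carrier P" "y \<in> carrier P" "z \<in> carrier P"
    show "x \<sqsubseteq>\<^bsub>P\<^esub> z"
      unfolding prod_le
    proof
      fix i assume i: "i \<in> I"
      interpret partial_order "M i" by (rule po[OF i])
      show "x i \<sqsubseteq>\<^bsub>M i\<^esub> z i"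
        using xyz i le_trans[of "x i" "y i" "z i"] by (auto simp: prod_le component_closed)
    qed
  \<comment> \<open>What remains are the equivalence and congruence axioms for \<open>.=\<close>,
    immediate because it is equality.\<close>
  qed (auto simp: eq)
qed

lemma components_subset: "\<lbrakk>A \<subseteq> carrier P; i \<in> I\<rbrakk> \<Longrightarrow> (\<lambda>x. x i) ` A \<subseteq> carrier (M i)"
  by (auto simp: component_closed)

text \<open>Lying below \<open>y\<close> is tested coordinatewise, so the equivalence is an exchange
  of the quantifiers over \<open>I\<close> and \<open>A\<close>. It concerns an explicit candidate
  because the join operator of \<open>P\<close> has no usable meaning until joins in
  \<open>P\<close> are known to exist.\<close>

lemma
  assumes A: "A \<subseteq> carrier P"
  defines "s \<equiv> \<lambda>i\<in>I. \<Squnion>\<^bsub>M i\<^esub>((\<lambda>x. x i) ` A)"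
  shows prod_sup_closed: "s \<in> carrier P"
    and prod_sup_le_iff: "y \<in> carrier P \<Longrightarrow> s \<sqsubseteq>\<^bsub>P\<^esub> y \<longleftrightarrow> (\<forall>a\<in>A. a \<sqsubseteq>\<^bsub>P\<^esub> y)"
proof -
  show "s \<in> carrier P"
    unfolding s_def prod_carrier
    using sup_lattice.sup_in_carrier[OF sup_lattice_factor components_subset[OF A]] by auto
  show "s \<sqsubseteq>\<^bsub>P\<^esub> y \<longleftrightarrow> (\<forall>a\<in>A. a \<sqsubseteq>\<^bsub>P\<^esub> y)" if "y \<in> carrier P"
    using sup_lattice.sup_le_iff[OF sup_lattice_factor components_subset[OF A]
        component_closed[OF that]]
    unfolding s_def prod_le by auto
qed

lemma prod_sup_lattice: "sup_lattice P"
proof -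
  interpret partial_order P by (rule prod_partial_order)
  show ?thesis
  proof
    fix A assume A: "A \<subseteq> carrier P"
    let ?s = "\<lambda>i\<in>I. \<Squnion>\<^bsub>M i\<^esub>((\<lambda>x. x i) ` A)"
    note s = prod_sup_closed[OF A] and le_iff = prod_sup_le_iff[OF A]
    have "is_lub P ?s A"
    proof (rule least_UpperI[OF _ _ A s])
      \<comment> \<open>At \<open>y = ?s\<close> the equivalence turns reflexivity into the upper
        bound property; at any other upper bound it gives leastness.\<close>
      show "x \<sqsubseteq>\<^bsub>P\<^esub> ?s" if "x \<in> A" for x using le_iff[OF s] le_refl[OF s] that by blast
      show "?s \<sqsubseteq>\<^bsub>P\<^esub> y" if "y \<in> Upper P A" for y
        using le_iff[of y] that A by (simp add: Upper_def subset_eq)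
    qed
    then show "\<exists>s. is_lub P s A" by blast
  qed
qed

lemma prod_sup: "A \<subseteq> carrier P \<Longrightarrow> \<Squnion>\<^bsub>P\<^esub>A = (\<lambda>i\<in>I. \<Squnion>\<^bsub>M i\<^esub>((\<lambda>x. x i) ` A))"
  by (intro sup_lattice.sup_eqI[OF prod_sup_lattice] prod_sup_closed prod_sup_le_iff)

section \<open>The module structure of the product\<close>

lemma prod_act_closed: "\<lbrakk>q \<in> carrier Q; x \<in> carrier P\<rbrakk> \<Longrightarrow> q \<star>\<^bsub>P\<^esub> x \<in> carrier P"
  using quantale_action.act_closed[OF action _ component_closed]
  by (simp add: prod_act prod_carrier)

text \<open>Once \<open>prod_sup\<close> has made the joins coordinatewise, each law reduces at
  coordinate \<open>i\<close> to the same law of \<open>M i\<close>.\<close>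

lemma prod_action: "quantale_action Q P"
proof (intro quantale_action.intro quantale prod_sup_lattice quantale_action_axioms.intro)
  fix q m assume "q \<in> carrier Q" "m \<in> carrier P"
  then show "q \<star>\<^bsub>P\<^esub> m \<in> carrier P" by (rule prod_act_closed)
next
  fix A m assume A: "A \<subseteq> carrier Q" and m: "m \<in> carrier P"
  have sub: "(\<lambda>q. q \<star>\<^bsub>P\<^esub> m) ` A \<subseteq> carrier P"
    using A m by (auto intro!: prod_act_closed)
  show "(\<Squnion>\<^bsub>Q\<^esub>A) \<star>\<^bsub>P\<^esub> m = \<Squnion>\<^bsub>P\<^esub>((\<lambda>q. q \<star>\<^bsub>P\<^esub> m) ` A)"
    unfolding prod_sup[OF sub]
    using quantale_action.act_join_scalar[OF action A component_closed[OF m]]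
    by (auto simp: prod_act image_image intro!: restrict_ext)
next
  fix q B assume q: "q \<in> carrier Q" and B: "B \<subseteq> carrier P"
  have sub: "(\<lambda>m. q \<star>\<^bsub>P\<^esub> m) ` B \<subseteq> carrier P"
    using q B by (auto intro!: prod_act_closed)
  show "q \<star>\<^bsub>P\<^esub> (\<Squnion>\<^bsub>P\<^esub>B) = \<Squnion>\<^bsub>P\<^esub>((\<lambda>m. q \<star>\<^bsub>P\<^esub> m) ` B)"
    unfolding prod_sup[OF sub] prod_sup[OF B]
    using quantale_action.act_join_vector[OF action q components_subset[OF B]]
    by (auto simp: prod_act image_image intro!: restrict_ext)
next
  \<comment> \<open>The monoid provides that \<open>qunit Q\<close> lies in the carrier of
    \<open>Q\<close>, which is needed for the scaled family to lie in the product.\<close>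
  interpret monoid "mult_monoid Q" by (rule quantale.is_monoid[OF quantale])
  fix m assume m: "m \<in> carrier P"
  then show "qunit Q \<star>\<^bsub>P\<^esub> m = m"
    using one_closed quantale_action.act_unit[OF action component_closed[OF m]]
    by (intro prod_eqI prod_act_closed) (auto simp: prod_act)
qed

text \<open>Only associativity depends on the side, and in both cases it is inherited
  coordinatewise.\<close>

lemma prod_is_qmodule:
  assumes mods: "\<And>i. i \<in> I \<Longrightarrow> qmodule s Q (M i)"
  shows "qmodule s Q P"
proof (cases s)
  case Left
  then have "left_qmodule Q (M i)" if "i \<in> I" for i
    using mods[OF that] by (simp add: qmodule_def)
  note assoc = left_qmodule.act_assoc[OF this _ _ component_closed]
  have "left_qmodule Q P"
    by (intro left_qmodule.intro prod_action left_qmodule_axioms.intro)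
      (simp add: prod_act assoc cong: restrict_cong)
  then show ?thesis by (simp add: Left qmodule_def)
next
  case Right
  then have "right_qmodule Q (M i)" if "i \<in> I" for i
    using mods[OF that] by (simp add: qmodule_def)
  note assoc = right_qmodule.act_assoc[OF this _ _ component_closed]
  have "right_qmodule Q P"
    by (intro right_qmodule.intro prod_action right_qmodule_axioms.intro)
      (simp add: prod_act assoc cong: restrict_cong)
  then show ?thesis by (simp add: Right qmodule_def)
qed

section \<open>The injections\<close>

lemma coproj_apply:
  "\<lbrakk>x \<in> carrier (M i); j \<in> I\<rbrakk> \<Longrightarrow> coproj I M i x j = (if j = i then x else \<bottom>\<^bsub>M j\<^esub>)"
  by (simp add: coproj_def)

lemma coproj_closed: "x \<in> carrier (M i) \<Longrightarrow> coproj I M i x \<in> carrier P"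
  using sup_lattice.bottom_in_carrier[OF sup_lattice_factor]
  by (auto simp: coproj_def prod_carrier)

text \<open>The bottom entries away from \<open>i\<close> impose no condition. This is a Galois
  connection: the injection is the lower adjoint of the projection, which is why it preserves
  joins.\<close>

lemma coproj_le_iff:
  assumes i: "i \<in> I" and x: "x \<in> carrier (M i)" and y: "y \<in> carrier P"
  shows "coproj I M i x \<sqsubseteq>\<^bsub>P\<^esub> y \<longleftrightarrow> x \<sqsubseteq>\<^bsub>M i\<^esub> y i"
  using i sup_lattice.bottom_le[OF sup_lattice_factor component_closed[OF y]]
  by (auto simp: prod_le coproj_apply[OF x])

lemma coproj_hom:
  assumes i: "i \<in> I"
  shows "coproj I M i \<in> qmodule_hom Q (M i) P"
proof -
  interpret Mi: quantale_action Q "M i" by (rule action[OF i])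
  show ?thesis
    unfolding qmodule_hom_def
  proof (intro CollectI conjI allI impI ballI)
    show "coproj I M i \<in> carrier (M i) \<rightarrow>\<^sub>E carrier P"
      using coproj_closed by (auto simp: coproj_def)
  next
    fix A assume A: "A \<subseteq> carrier (M i)"
    note sup = Mi.M.sup_in_carrier[OF A]
    have "\<Squnion>\<^bsub>P\<^esub>(coproj I M i ` A) = coproj I M i (\<Squnion>\<^bsub>M i\<^esub>A)"
    proof (rule sup_lattice.sup_eqI[OF prod_sup_lattice])
      show "coproj I M i ` A \<subseteq> carrier P" using A coproj_closed by auto
      show "coproj I M i (\<Squnion>\<^bsub>M i\<^esub>A) \<in> carrier P" by (rule coproj_closed[OF sup])
      fix y assume y: "y \<in> carrier P"
      \<comment> \<open>By the adjunction, both sides say that every element of \<open>A\<close>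
        lies below \<open>y i\<close>.\<close>
      show "coproj I M i (\<Squnion>\<^bsub>M i\<^esub>A) \<sqsubseteq>\<^bsub>P\<^esub> y \<longleftrightarrow> (\<forall>a\<in>coproj I M i ` A. a \<sqsubseteq>\<^bsub>P\<^esub> y)"
        using A coproj_le_iff[OF i _ y] Mi.M.sup_le_iff[OF A component_closed[OF y i]] sup
        by (simp add: subset_eq)
    qed
    then show "coproj I M i (\<Squnion>\<^bsub>M i\<^esub>A) = \<Squnion>\<^bsub>P\<^esub>(coproj I M i ` A)" by simp
  next
    fix q x assume q: "q \<in> carrier Q" and x: "x \<in> carrier (M i)"
    show "coproj I M i (q \<star>\<^bsub>M i\<^esub> x) = q \<star>\<^bsub>P\<^esub> coproj I M i x"
      \<comment> \<open>Away from coordinate \<open>i\<close> the equation says that a scalar fixes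
        bottom.\<close>
      using q x quantale_action.act_bottom[OF action q] Mi.act_closed[OF q x]
      by (intro prod_eqI coproj_closed prod_act_closed) (auto simp: coproj_apply prod_act)
  qed
qed

text \<open>By the adjunction, \<open>y\<close> bounds all injected components exactly when
  \<open>x i\<close> is below \<open>y i\<close> for every \<open>i\<close>, which is the order of
  the product. So the images of the injections generate the product under joins.\<close>

lemma sup_coproj_components:
  assumes x: "x \<in> carrier P"
  shows "\<Squnion>\<^bsub>P\<^esub>((\<lambda>i. coproj I M i (x i)) ` I) = x"
proof (rule sup_lattice.sup_eqI[OF prod_sup_lattice _ x])
  show "(\<lambda>i. coproj I M i (x i)) ` I \<subseteq> carrier P"
    using component_closed[OF x] coproj_closed by auto
  fix y assume "y \<in> carrier P"
  then show "x \<sqsubseteq>\<^bsub>P\<^esub> y \<longleftrightarrow> (\<forall>a\<in>(\<lambda>i. coproj I M i (x i)) ` I. a \<sqsubseteq>\<^bsub>P\<^esub> y)"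
    using coproj_le_iff component_closed[OF x] by (auto simp: prod_le)
qed

lemma proj_coproj:
  assumes "i \<in> I"
  shows "compose (carrier (M i)) (proj I M i) (coproj I M i) = (\<lambda>x\<in>carrier (M i). x)"
  using assms coproj_closed
  by (auto simp: compose_def proj_def coproj_apply intro!: restrict_ext)

end

section \<open>The mediating morphism of a cocone\<close>

locale action_cocone = action_family Q I M + N: quantale_action Q N
  for Q :: "'q quantale" and I :: "'i set" and M :: "'i \<Rightarrow> ('q, 'm) qmodule"
    and N :: "('q, 'n) qmodule" +
  fixes f :: "'i \<Rightarrow> 'm \<Rightarrow> 'n"
  assumes cocone: "i \<in> I \<Longrightarrow> f i \<in> qmodule_hom Q (M i) N"
begin

text \<open>The formula is forced by \<open>sup_coproj_components\<close>; the restriction provides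
  the extensionality that \<open>qmodule_hom\<close> demands.\<close>

definition mediator :: "('i \<Rightarrow> 'm) \<Rightarrow> 'n" where
  "mediator = (\<lambda>x\<in>carrier P. \<Squnion>\<^bsub>N\<^esub>((\<lambda>i. f i (x i)) ` I))"

lemma images_subset: "x \<in> carrier P \<Longrightarrow> (\<lambda>i. f i (x i)) ` I \<subseteq> carrier N"
  using hom_closed[OF cocone component_closed] by blast

lemma mediator_apply: "x \<in> carrier P \<Longrightarrow> mediator x = \<Squnion>\<^bsub>N\<^esub>((\<lambda>i. f i (x i)) ` I)"
  by (simp add: mediator_def)

lemma mediator_closed: "x \<in> carrier P \<Longrightarrow> mediator x \<in> carrier N"
  using N.M.sup_in_carrier[OF images_subset] by (simp add: mediator_apply)

lemma mediator_le_iff: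
  "\<lbrakk>x \<in> carrier P; y \<in> carrier N\<rbrakk> \<Longrightarrow> mediator x \<sqsubseteq>\<^bsub>N\<^esub> y \<longleftrightarrow> (\<forall>i\<in>I. f i (x i) \<sqsubseteq>\<^bsub>N\<^esub> y)"
  using N.M.sup_le_iff[OF images_subset] by (simp add: mediator_apply)

text \<open>The interchange of joins is carried out on upper bounds: \<open>y\<close> bounds either
  side exactly when \<open>f i (a i)\<close> is below \<open>y\<close> for all \<open>i\<close> in
  \<open>I\<close> and \<open>a\<close> in \<open>A\<close>.\<close>

lemma mediator_sup:
  assumes A: "A \<subseteq> carrier P"
  shows "mediator (\<Squnion>\<^bsub>P\<^esub>A) = \<Squnion>\<^bsub>N\<^esub>(mediator ` A)"
proof (rule N.M.sup_eqI[symmetric])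
  note sup = sup_lattice.sup_in_carrier[OF prod_sup_lattice A]
  show "mediator ` A \<subseteq> carrier N" using A mediator_closed by auto
  show "mediator (\<Squnion>\<^bsub>P\<^esub>A) \<in> carrier N" by (rule mediator_closed[OF sup])
  fix y assume y: "y \<in> carrier N"
  \<comment> \<open>At a single index, the join in \<open>P\<close> is a join in \<open>M i\<close>,
    and \<open>f i\<close> preserves it.\<close>
  have "f i ((\<Squnion>\<^bsub>P\<^esub>A) i) \<sqsubseteq>\<^bsub>N\<^esub> y \<longleftrightarrow> (\<forall>a\<in>A. f i (a i) \<sqsubseteq>\<^bsub>N\<^esub> y)" if i: "i \<in> I" for i
  proof -
    have sub: "f i ` (\<lambda>x. x i) ` A \<subseteq> carrier N"
      using A i by (auto intro!: hom_closed[OF cocone] component_closed)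
    have "f i ((\<Squnion>\<^bsub>P\<^esub>A) i) = \<Squnion>\<^bsub>N\<^esub>(f i ` (\<lambda>x. x i) ` A)"
      using hom_sup[OF cocone[OF i] components_subset[OF A i]] i by (simp add: prod_sup[OF A])
    then show ?thesis using N.M.sup_le_iff[OF sub y] by simp
  qed
  then have "mediator (\<Squnion>\<^bsub>P\<^esub>A) \<sqsubseteq>\<^bsub>N\<^esub> y \<longleftrightarrow> (\<forall>a\<in>A. \<forall>i\<in>I. f i (a i) \<sqsubseteq>\<^bsub>N\<^esub> y)"
    by (auto simp: mediator_le_iff[OF sup y])
  also have "\<dots> \<longleftrightarrow> (\<forall>a\<in>A. mediator a \<sqsubseteq>\<^bsub>N\<^esub> y)"
    using A by (intro ball_cong refl mediator_le_iff[OF _ y, symmetric]) blast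
  finally show "mediator (\<Squnion>\<^bsub>P\<^esub>A) \<sqsubseteq>\<^bsub>N\<^esub> y \<longleftrightarrow> (\<forall>b\<in>mediator ` A. b \<sqsubseteq>\<^bsub>N\<^esub> y)" by simp
qed

lemma mediator_act:
  assumes q: "q \<in> carrier Q" and x: "x \<in> carrier P"
  shows "mediator (q \<star>\<^bsub>P\<^esub> x) = q \<star>\<^bsub>N\<^esub> mediator x"
proof -
  \<comment> \<open>Each \<open>f i\<close> commutes with the action, so the set being joined is a
    scaled set; \<open>act_join_vector\<close> then pulls \<open>q\<close> out of the join.\<close>
  have "(\<lambda>i. f i ((q \<star>\<^bsub>P\<^esub> x) i)) ` I = (\<lambda>m. q \<star>\<^bsub>N\<^esub> m) ` (\<lambda>i. f i (x i)) ` I"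
    unfolding image_image
    using hom_act[OF cocone q component_closed[OF x]] by (intro image_cong) (auto simp: prod_act)
  then show ?thesis
    using N.act_join_vector[OF q images_subset[OF x]]
    by (simp add: mediator_apply x prod_act_closed[OF q x])
qed

lemma mediator_hom: "mediator \<in> qmodule_hom Q P N"
  using mediator_closed mediator_sup mediator_act
  by (auto simp: qmodule_hom_def mediator_def)

lemma mediator_coproj:
  assumes i: "i \<in> I"
  shows "compose (carrier (M i)) mediator (coproj I M i) = f i"
proof (rule extensionalityI[OF compose_extensional hom_extensional[OF cocone[OF i]]])
  fix x assume x: "x \<in> carrier (M i)"
  have fx: "f i x \<in> carrier N" by (rule hom_closed[OF cocone[OF i] x])
  have "\<Squnion>\<^bsub>N\<^esub>((\<lambda>j. f j (coproj I M i x j)) ` I) = f i x"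
  proof (rule N.M.sup_eqI[OF images_subset[OF coproj_closed[OF x]] fx])
    fix y assume "y \<in> carrier N"
    then show "f i x \<sqsubseteq>\<^bsub>N\<^esub> y \<longleftrightarrow> (\<forall>a\<in>(\<lambda>j. f j (coproj I M i x j)) ` I. a \<sqsubseteq>\<^bsub>N\<^esub> y)"
      \<comment> \<open>For \<open>j\<close> other than \<open>i\<close> the term is
        \<open>f j\<close> at bottom, hence bottom and below every \<open>y\<close>; only the term
        at \<open>i\<close> constrains \<open>y\<close>.\<close>
      using i N.M.bottom_le hom_bottom[OF cocone] by (auto simp: coproj_apply[OF x])
  qed
  then show "compose (carrier (M i)) mediator (coproj I M i) x = f i x"
    by (simp add: compose_def x mediator_apply coproj_closed)
qed

text \<open>The commuting equations fix \<open>g\<close> on the injected components, and these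
  generate the product under joins.\<close>

lemma mediator_unique:
  assumes g: "g \<in> qmodule_hom Q P N"
    and comm: "\<And>i. i \<in> I \<Longrightarrow> compose (carrier (M i)) g (coproj I M i) = f i"
  shows "g = mediator"
proof (rule extensionalityI[OF hom_extensional[OF g] hom_extensional[OF mediator_hom]])
  fix x assume x: "x \<in> carrier P"
  have sub: "(\<lambda>i. coproj I M i (x i)) ` I \<subseteq> carrier P"
    using component_closed[OF x] coproj_closed by auto
  have "g (coproj I M i (x i)) = f i (x i)" if "i \<in> I" for i
    using fun_cong[OF comm[OF that], of "x i"] component_closed[OF x that]
    by (simp add: compose_def)
  then show "g x = mediator x"
    using hom_sup[OF g sub] by (simp add: sup_coproj_components x mediator_apply image_image)
qed

end

theorem proposition4p2p3:
  fixes s :: side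
    and Q :: "'q quantale"
    and I :: "'i set"
    and M :: "'i \<Rightarrow> ('q, 'm) qmodule"
  assumes "quantale Q"
    and "\<And>i. i \<in> I \<Longrightarrow> qmodule s Q (M i)"
  shows "is_coproduct TYPE('n) s Q I M (prod_qmodule I M) (coproj I M)
    \<and> (\<forall>i\<in>I. compose (carrier (M i)) (proj I M i) (coproj I M i)
               = (\<lambda>x\<in>carrier (M i). x))"
proof -
  interpret action_family Q I M
    by (rule action_family.intro[OF assms(1) qmodule_action[OF assms(2)]])
  have "\<exists>!g. g \<in> qmodule_hom Q P N \<and> (\<forall>i\<in>I. compose (carrier (M i)) g (coproj I M i) = f i)"
    if N: "qmodule s Q N" and f: "\<forall>i\<in>I. f i \<in> qmodule_hom Q (M i) N"
    for N :: "('q, 'n) qmodule" and f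
  proof -
    \<comment> \<open>Passing to \<open>quantale_action\<close> lets one argument serve left and
      right test modules alike.\<close>
    interpret action_cocone Q I M N f
      using action_family_axioms qmodule_action[OF N] f
      by (simp add: action_cocone_def action_cocone_axioms_def)
    show ?thesis
      using mediator_hom mediator_coproj mediator_unique by blast
  qed
  then show ?thesis
    using prod_is_qmodule[OF assms(2)] coproj_hom proj_coproj by (simp add: is_coproduct_def)
qed

end
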